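(* Let $G_1,G_2$ be topological groups, let $p_1\colon E_1\to B_1$ be a $G_1$-fibration and let $p_2\colon E_2\to B_2$ be a $G_2$-fibration. If $E_1\times E_1\times E_2\times E_2$ is $(G_1\times G_1\times G_2\times G_2)$-completely normal, then $$\mathrm{TC}^{G_1\times G_2}[p_1\times p_2\colon E_1\times E_2\to B_1\times B_2]\le\mathrm{TC}^{G_1}[p_1\colon E_1\to B_1]+\mathrm{TC}^{G_2}[p_2\colon E_2\to B_2]-1.$$
   Context: All spaces are Hausdorff, $I=[0,1]$, path spaces carry the compact-open topology. A $G$-map is a continuous equivariant map; a $G$-homotopy is an equivariant homotopy ($G$ acting trivially on $I$). A $G$-fibration is a $G$-map with the $G$-homotopy lifting property with respect to every $G$-space. Products of groups act componentwise on products of spaces. A $G$-space $X$ is $G$-completely normal if for any two $G$-invariant subsets $A,A'$ of $X$ with $\overline{A}\cap A'=A\cap\overline{A'}=\emptyset$ there exist disjoint $G$-invariant open subsets of $X$ containing $A$ and $A'$, respectively. Equivariant sectional category: for a $G$-map $q\colon X\to Y$, $\mathrm{secat}_G(q)$ is the least positive integer $k$ such that $Y$ has a cover by $G$-invariant open sets $U_1,\dots,U_k$ with $G$-maps $s_i\colon U_i\to X$ such that $q\circ s_i$ is $G$-homotopic to the inclusion $U_i\hookrightarrow Y$ ($\infty$ if there is no such $k$). Invariant parametrized topological complexity: for a $G$-fibration $p\colon E\to B$, let $E^I_B$ be the space of paths $\gamma\colon I\to E$ whose image lies in a single fibre of $p$, with $(g\cdot\gamma)(t)=g\cdot\gamma(t)$.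 Put $E^I_B\times_{E/G}E^I_B=\{(\gamma,\delta)\in E^I_B\times E^I_B : G\cdot\gamma(1)=G\cdot\delta(0)\}$ and $E\times_{B/G}E=\{(e_1,e_2)\in E\times E : G\cdot p(e_1)=G\cdot p(e_2)\}$, with the componentwise $(G\times G)$-actions, and let $\Psi(\gamma,\delta)=(\gamma(0),\delta(1))$, a $(G\times G)$-fibration $E^I_B\times_{E/G}E^I_B\to E\times_{B/G}E$. Then $\mathrm{TC}^G[p\colon E\to B]:=\mathrm{secat}_{G\times G}(\Psi)$. *)

theory Defs
  imports "HOL-Analysis.Analysis" "HOL-Algebra.Group_Action" "HOL-Library.Extended_Nat"
begin

section \<open>Topological groups and \<open>G\<close>-spaces\<close>

text \<open>
  Groups are HOL-Algebra structures and spaces are abstract topologies, so that subspaces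
  and their products are again spaces. All spaces are Hausdorff, including the groups and
  the test spaces in the homotopy lifting property.
\<close>

locale topological_group = group G for G (structure) +
  fixes T :: "'g topology"
  assumes topspace_group: "topspace T = carrier G"
    and Hausdorff_group: "Hausdorff_space T"
    and continuous_mult: "continuous_map (prod_topology T T) T (\<lambda>(x, y). x \<otimes> y)"
    and continuous_inv: "continuous_map T T (\<lambda>x. inv x)"

text \<open>
  An action is a function \<open>a\<close> whose values outside the carrier and outside the space are
  irrelevant; \<^const>\<open>group_action\<close> asks for extensional bijections, whence the restriction.
\<close>

definition G_space ::
    "('g, 'm) monoid_scheme \<Rightarrow> 'g topology \<Rightarrow> 'x topology \<Rightarrow> ('g \<Rightarrow> 'x \<Rightarrow> 'x) \<Rightarrow> bool" where
  "G_space G T X a \<longleftrightarrow>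
     topological_group G T \<and> Hausdorff_space X \<and>
     group_action G (topspace X) (\<lambda>g. restrict (a g) (topspace X)) \<and>
     continuous_map (prod_topology T X) X (\<lambda>(g, x). a g x)"

definition G_invariant :: "('g, 'm) monoid_scheme \<Rightarrow> ('g \<Rightarrow> 'x \<Rightarrow> 'x) \<Rightarrow> 'x set \<Rightarrow> bool" where
  "G_invariant G a A \<longleftrightarrow> (\<forall>g\<in>carrier G. \<forall>x\<in>A. a g x \<in> A)"

definition equivariant_on ::
    "('g, 'm) monoid_scheme \<Rightarrow> 'x set \<Rightarrow> ('g \<Rightarrow> 'x \<Rightarrow> 'x) \<Rightarrow> ('g \<Rightarrow> 'y \<Rightarrow> 'y) \<Rightarrow> ('x \<Rightarrow> 'y) \<Rightarrow> bool" where
  "equivariant_on G S a b f \<longleftrightarrow> (\<forall>g\<in>carrier G. \<forall>x\<in>S. f (a g x) = b g (f x))"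

definition G_map ::
    "('g, 'm) monoid_scheme \<Rightarrow> 'x topology \<Rightarrow> ('g \<Rightarrow> 'x \<Rightarrow> 'x) \<Rightarrow> 'y topology \<Rightarrow> ('g \<Rightarrow> 'y \<Rightarrow> 'y)
      \<Rightarrow> ('x \<Rightarrow> 'y) \<Rightarrow> bool" where
  "G_map G X a Y b f \<longleftrightarrow> continuous_map X Y f \<and> equivariant_on G (topspace X) a b f"

definition G_homotopic ::
    "('g, 'm) monoid_scheme \<Rightarrow> 'x topology \<Rightarrow> ('g \<Rightarrow> 'x \<Rightarrow> 'x) \<Rightarrow> 'y topology \<Rightarrow> ('g \<Rightarrow> 'y \<Rightarrow> 'y)
      \<Rightarrow> ('x \<Rightarrow> 'y) \<Rightarrow> ('x \<Rightarrow> 'y) \<Rightarrow> bool" where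
  "G_homotopic G X a Y b = homotopic_with (equivariant_on G (topspace X) a b) X Y"

definition prod_act :: "('g \<Rightarrow> 'x \<Rightarrow> 'x) \<Rightarrow> ('h \<Rightarrow> 'y \<Rightarrow> 'y) \<Rightarrow> 'g \<times> 'h \<Rightarrow> 'x \<times> 'y \<Rightarrow> 'x \<times> 'y" where
  "prod_act a b = (\<lambda>(g, h). map_prod (a g) (b h))"

definition G_completely_normal ::
    "('g, 'm) monoid_scheme \<Rightarrow> 'x topology \<Rightarrow> ('g \<Rightarrow> 'x \<Rightarrow> 'x) \<Rightarrow> bool" where
  "G_completely_normal G X a \<longleftrightarrow>
     (\<forall>A A'. G_invariant G a A \<and> G_invariant G a A' \<and> separatedin X A A' \<longrightarrow>
        (\<exists>U U'. openin X U \<and> openin X U' \<and> G_invariant G a U \<and> G_invariant G a U' \<and>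
                A \<subseteq> U \<and> A' \<subseteq> U' \<and> disjnt U U'))"


section \<open>Path spaces\<close>

abbreviation unit_interval :: "real topology" where
  "unit_interval \<equiv> top_of_set {0..1}"

text \<open>
  Maps out of \<open>X\<close> are represented by extensional functions, so that a map is determined by
  its values on \<open>X\<close>.
\<close>

definition compact_open_topology :: "'x topology \<Rightarrow> 'y topology \<Rightarrow> ('x \<Rightarrow> 'y) topology" where
  "compact_open_topology X Y =
     topology_generated_by
       {{f \<in> extensional (topspace X). continuous_map X Y f \<and> f ` K \<subseteq> U} | K U.
          compactin X K \<and> openin Y U}"

abbreviation path_space :: "'x topology \<Rightarrow> (real \<Rightarrow> 'x) topology" where
  "path_space X \<equiv> compact_open_topology unit_interval X"

definition path_act :: "('g \<Rightarrow> 'x \<Rightarrow> 'x) \<Rightarrow> 'g \<Rightarrow> (real \<Rightarrow> 'x) \<Rightarrow> real \<Rightarrow> 'x" where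
  "path_act a g \<gamma> = restrict (\<lambda>t. a g (\<gamma> t)) {0..1}"


section \<open>\<open>G\<close>-fibrations\<close>

definition G_HLP ::
    "('g, 'm) monoid_scheme \<Rightarrow> 'e topology \<Rightarrow> ('g \<Rightarrow> 'e \<Rightarrow> 'e) \<Rightarrow> 'b topology \<Rightarrow> ('g \<Rightarrow> 'b \<Rightarrow> 'b)
      \<Rightarrow> ('e \<Rightarrow> 'b) \<Rightarrow> 'x topology \<Rightarrow> ('g \<Rightarrow> 'x \<Rightarrow> 'x) \<Rightarrow> bool" where
  "G_HLP G E aE B aB p X aX \<longleftrightarrow>
     (\<forall>f H. G_map G X aX E aE f \<and>
            G_map G (prod_topology unit_interval X) (\<lambda>g. map_prod id (aX g)) B aB H \<and>
            (\<forall>x\<in>topspace X. H (0, x) = p (f x)) \<longrightarrow>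
        (\<exists>K. G_map G (prod_topology unit_interval X) (\<lambda>g. map_prod id (aX g)) E aE K \<and>
             (\<forall>x\<in>topspace X. K (0, x) = f x) \<and>
             (\<forall>t\<in>{0..1}. \<forall>x\<in>topspace X. p (K (t, x)) = H (t, x))))"

text \<open>
  One cannot quantify over types inside a definition, so the test spaces range over all
  \<open>G\<close>-spaces carried by a subset of the type \<^typ>\<open>'e \<times> (real \<Rightarrow> 'b)\<close>, which is
  large enough to contain the mapping path space of \<open>p\<close>. Lemma \<open>G_fibration_HLP\<close> below shows
  that a \<open>G\<close>-fibration then has the homotopy lifting property for all \<open>G\<close>-spaces of all types.
\<close>

definition G_fibration ::
    "('g, 'm) monoid_scheme \<Rightarrow> 'g topology \<Rightarrow> 'e topology \<Rightarrow> ('g \<Rightarrow> 'e \<Rightarrow> 'e)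
      \<Rightarrow> 'b topology \<Rightarrow> ('g \<Rightarrow> 'b \<Rightarrow> 'b) \<Rightarrow> ('e \<Rightarrow> 'b) \<Rightarrow> bool" where
  "G_fibration G T E aE B aB p \<longleftrightarrow>
     G_space G T E aE \<and> G_space G T B aB \<and> G_map G E aE B aB p \<and>
     (\<forall>(X :: ('e \<times> (real \<Rightarrow> 'b)) topology) aX. G_space G T X aX \<longrightarrow> G_HLP G E aE B aB p X aX)"


subsection \<open>The test spaces in the definition suffice\<close>

lemma G_space_iff:
  "G_space G T X a \<longleftrightarrow>
     topological_group G T \<and> Hausdorff_space X \<and>
     (\<forall>x\<in>topspace X. a \<one>\<^bsub>G\<^esub> x = x) \<and>
     (\<forall>g\<in>carrier G. \<forall>h\<in>carrier G. \<forall>x\<in>topspace X. a (g \<otimes>\<^bsub>G\<^esub> h) x = a g (a h x)) \<and>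
     continuous_map (prod_topology T X) X (\<lambda>(g, x). a g x)"
  (is "?L \<longleftrightarrow> ?R")
proof
  assume L: ?L
  then interpret topological_group G T
    by (simp add: G_space_def)
  interpret group_action G "topspace X" "\<lambda>g. restrict (a g) (topspace X)"
    using L by (simp add: G_space_def)
  have "a \<one>\<^bsub>G\<^esub> x = x" if "x \<in> topspace X" for x
    using id_eq_one that by (metis restrict_apply')
  moreover have "a (g \<otimes>\<^bsub>G\<^esub> h) x = a g (a h x)"
    if "g \<in> carrier G" "h \<in> carrier G" "x \<in> topspace X" for g h x
    using composition_rule[OF that(3,1,2)] element_image[OF that(2,3) refl] that by simp
  ultimately show ?R
    using L by (simp add: G_space_def)
next
  assume R: ?R
  then interpret topological_group G T
    by simp
  let ?S = "topspace X"
  have one: "a \<one>\<^bsub>G\<^esub> x = x" if "x \<in> ?S" for x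
    using R that by blast
  have mult: "a (g \<otimes>\<^bsub>G\<^esub> h) x = a g (a h x)"
    if "g \<in> carrier G" "h \<in> carrier G" "x \<in> ?S" for g h x
    using R that by blast
  have in_S: "a g x \<in> ?S" if "g \<in> carrier G" "x \<in> ?S" for g x
    using R that continuous_map_image_subset_topspace[of "prod_topology T X" X "\<lambda>(g, x). a g x"]
    by (force simp: topspace_group)
  have Bij: "restrict (a g) ?S \<in> Bij ?S" if g: "g \<in> carrier G" for g
  proof -
    have "a (inv\<^bsub>G\<^esub> g) (a g x) = x" "a g (a (inv\<^bsub>G\<^esub> g) x) = x" if "x \<in> ?S" for x
      using mult[of "inv\<^bsub>G\<^esub> g" g x] mult[of g "inv\<^bsub>G\<^esub> g" x] one g that by auto
    then have "bij_betw (a g) ?S ?S"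
      using g in_S by (intro bij_betwI[where g = "a (inv\<^bsub>G\<^esub> g)"]) auto
    then show ?thesis
      by (auto simp: Bij_def)
  qed
  have "group_hom G (BijGroup ?S) (\<lambda>g. restrict (a g) ?S)"
  proof (intro group_hom.intro group_hom_axioms.intro)
    show "(\<lambda>g. restrict (a g) ?S) \<in> hom G (BijGroup ?S)"
      using Bij in_S mult by (auto simp: hom_def BijGroup_def compose_def fun_eq_iff)
  qed (auto simp: is_group group_BijGroup)
  then show ?L
    using R by (simp add: G_space_def group_action_def)
qed

lemma G_space_closed:
  assumes "G_space G T X a" "g \<in> carrier G" "x \<in> topspace X"
  shows "a g x \<in> topspace X"
  using assms continuous_map_image_subset_topspace[of "prod_topology T X" X "\<lambda>(g, x). a g x"]
  by (force simp: G_space_def topological_group.topspace_group)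

lemma continuous_map_apply_snd:
  "continuous_map Y Z h \<Longrightarrow> continuous_map (prod_topology X Y) Z (\<lambda>z. h (snd z))"
  using continuous_map_compose[OF continuous_map_snd] by (simp add: o_def)

lemma topspace_path_space:
  "topspace (path_space X) = {f \<in> extensional {0..1}. continuous_map unit_interval X f}"
proof -
  have "f \<in> topspace (path_space X)"
    if "f \<in> extensional {0..1}" "continuous_map unit_interval X f" for f
    unfolding compact_open_topology_def topology_generated_by_topspace
    using that by (intro UnionI[where X = "{f \<in> extensional (topspace unit_interval).
      continuous_map unit_interval X f \<and> f ` {} \<subseteq> topspace X}"] CollectI exI[of _ "{}"]
        exI[of _ "topspace X"]) auto
  then show ?thesis
    unfolding compact_open_topology_def topology_generated_by_topspace by fastforce
qed

lemma openin_path_space: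
  assumes "compactin unit_interval K" "openin X U"
  shows "openin (path_space X) {f \<in> topspace (path_space X). f ` K \<subseteq> U}"
proof -
  have *: "{f \<in> topspace (path_space X). f ` K \<subseteq> U} =
     {f \<in> extensional (topspace unit_interval). continuous_map unit_interval X f \<and> f ` K \<subseteq> U}"
    by (auto simp: topspace_path_space)
  show ?thesis
    unfolding * unfolding compact_open_topology_def
    by (rule topology_generated_by_Basis) (use assms in blast)
qed

lemma continuous_map_path_eval:
  "continuous_map (prod_topology unit_interval (path_space X)) X (\<lambda>(t, f). f t)"
  unfolding continuous_map_def
proof (intro conjI allI impI)
  show "(\<lambda>(t, f). f t) \<in> topspace (prod_topology unit_interval (path_space X)) \<rightarrow> topspace X"
    by (auto simp: topspace_path_space continuous_map_def Pi_iff)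
next
  fix U assume U: "openin X U"
  let ?W = "{z \<in> topspace (prod_topology unit_interval (path_space X)).
    (case z of (t, f) \<Rightarrow> f t) \<in> U}"
  have "\<exists>V. openin (prod_topology unit_interval (path_space X)) V \<and> (t, f) \<in> V \<and> V \<subseteq> ?W"
    if tf: "(t, f) \<in> ?W" for t f
  proof -
    have f: "continuous_map unit_interval X f" "f \<in> topspace (path_space X)" "f t \<in> U"
      "t \<in> {0..1}"
      using tf by (auto simp: topspace_path_space)
    have "compact_space unit_interval" "Hausdorff_space unit_interval"
      by (auto simp: compact_space_subtopology Hausdorff_space_subtopology)
    then have nb: "neighbourhood_base_of (compactin unit_interval) unit_interval"
      using compact_imp_locally_compact_space locally_compact_space_neighbourhood_base by blast
    have "openin unit_interval {s \<in> topspace unit_interval. f s \<in> U}"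
      using f(1) U by (rule openin_continuous_map_preimage)
    moreover have "t \<in> {s \<in> topspace unit_interval. f s \<in> U}"
      using f by simp
    ultimately obtain V K where VK: "openin unit_interval V" "compactin unit_interval K" "t \<in> V"
      "V \<subseteq> K" "K \<subseteq> {s \<in> topspace unit_interval. f s \<in> U}"
      using nb unfolding neighbourhood_base_of by meson
    let ?V = "V \<times> {h \<in> topspace (path_space X). h ` K \<subseteq> U}"
    have "openin (prod_topology unit_interval (path_space X)) ?V"
      using VK U by (simp add: openin_prod_Times_iff openin_path_space)
    moreover have "(t, f) \<in> ?V"
      using VK f by auto
    moreover have "?V \<subseteq> ?W"
      using VK openin_subset[OF VK(1)] by (auto simp: image_subset_iff)
    ultimately show ?thesis
      by blast
  qed
  then show "openin (prod_topology unit_interval (path_space X)) ?W"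
    by (subst openin_subopen) fast
qed

lemma continuous_map_path_curry:
  assumes h: "continuous_map (prod_topology unit_interval X) Y h"
  shows "continuous_map X (path_space Y) (\<lambda>x. restrict (\<lambda>t. h (t, x)) {0..1})"
proof -
  have path: "continuous_map unit_interval Y (\<lambda>t. h (t, x))" if "x \<in> topspace X" for x
    using that by (intro continuous_map_compose[OF _ h, unfolded o_def])
      (simp add: continuous_map_pairwise o_def)
  have path': "continuous_map unit_interval Y (restrict (\<lambda>t. h (t, x)) {0..1})"
    if "x \<in> topspace X" for x
    using path[OF that] by (rule continuous_map_eq) simp
  show ?thesis
    unfolding compact_open_topology_def
  proof (rule continuous_on_generated_topo)
    fix W assume "W \<in> {{f \<in> extensional (topspace unit_interval).
      continuous_map unit_interval Y f \<and> f ` K \<subseteq> U} | K U.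
        compactin unit_interval K \<and> openin Y U}"
    then obtain K U where K: "compactin unit_interval K" and U: "openin Y U"
      and W: "W = {f \<in> extensional (topspace unit_interval).
        continuous_map unit_interval Y f \<and> f ` K \<subseteq> U}"
      by blast
    have K01: "K \<subseteq> {0..1}"
      using compactin_subset_topspace[OF K] by simp
    let ?P = "{z \<in> topspace (prod_topology unit_interval X). h z \<in> U}"
    have P: "openin (prod_topology unit_interval X) ?P"
      using h U by (rule openin_continuous_map_preimage)
    have eq: "(\<lambda>x. restrict (\<lambda>t. h (t, x)) {0..1}) -` W \<inter> topspace X =
        {x \<in> topspace X. K \<times> {x} \<subseteq> ?P}"
      using K01 path' by (auto simp: W subset_iff image_iff)
    have "\<exists>V. openin X V \<and> x \<in> V \<and> V \<subseteq> {x \<in> topspace X. K \<times> {x} \<subseteq> ?P}"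
      if x: "x \<in> topspace X" "K \<times> {x} \<subseteq> ?P" for x
    proof -
      obtain A V where AV: "openin X V" "K \<subseteq> A" "x \<in> V" "A \<times> V \<subseteq> ?P"
        using tube_lemma_left[OF P K x] by blast
      then show ?thesis
        using openin_subset[OF AV(1)] by (intro exI[of _ V]) blast
    qed
    then show "openin X ((\<lambda>x. restrict (\<lambda>t. h (t, x)) {0..1}) -` W \<inter> topspace X)"
      unfolding eq by (subst openin_subopen) blast
  next
    show "(\<lambda>x. restrict (\<lambda>t. h (t, x)) {0..1}) ` topspace X \<subseteq>
      \<Union> {{f \<in> extensional (topspace unit_interval).
        continuous_map unit_interval Y f \<and> f ` K \<subseteq> U} | K U.
          compactin unit_interval K \<and> openin Y U}"
      using path' topspace_path_space[of Y]
      unfolding compact_open_topology_def topology_generated_by_topspace by auto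
  qed
qed

lemma Hausdorff_path_space:
  assumes "Hausdorff_space X"
  shows "Hausdorff_space (path_space X)"
  unfolding Hausdorff_space_def
proof (intro allI impI, elim conjE)
  fix f g assume fg: "f \<in> topspace (path_space X)" "g \<in> topspace (path_space X)" "f \<noteq> g"
  then obtain t where t: "t \<in> {0..1}" "f t \<noteq> g t"
    by (metis (no_types, lifting) extensionalityI mem_Collect_eq topspace_path_space)
  then have "f t \<in> topspace X" "g t \<in> topspace X"
    using fg by (auto simp: topspace_path_space continuous_map_def Pi_iff)
  then obtain U V where UV: "openin X U" "openin X V" "f t \<in> U" "g t \<in> V" "disjnt U V"
    using assms t unfolding Hausdorff_space_def by metis
  have K: "compactin unit_interval {t}"
    using t by simp
  show "\<exists>U V. openin (path_space X) U \<and> openin (path_space X) V \<and> f \<in> U \<and> g \<in> V \<and> disjnt U V"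
    using openin_path_space[OF K UV(1)] openin_path_space[OF K UV(2)] fg UV
    by (intro exI[of _ "{f \<in> topspace (path_space X). f ` {t} \<subseteq> U}"]
        exI[of _ "{f \<in> topspace (path_space X). f ` {t} \<subseteq> V}"]) (auto simp: disjnt_iff)
qed

lemma G_space_path_space:
  assumes X: "G_space G T X a"
  shows "G_space G T (path_space X) (path_act a)"
proof -
  from X interpret topological_group G T
    by (simp add: G_space_def)
  have X': "\<forall>x\<in>topspace X. a \<one>\<^bsub>G\<^esub> x = x"
    "\<forall>g\<in>carrier G. \<forall>h\<in>carrier G. \<forall>x\<in>topspace X. a (g \<otimes>\<^bsub>G\<^esub> h) x = a g (a h x)"
    "continuous_map (prod_topology T X) X (\<lambda>(g, x). a g x)"
    using X by (auto simp: G_space_iff)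
  have in_X: "f t \<in> topspace X" if "f \<in> topspace (path_space X)" "t \<in> {0..1}" for f t
    using that by (auto simp: topspace_path_space continuous_map_def Pi_iff)
  have ext: "restrict f {0..1} = f" if "f \<in> topspace (path_space X)" for f
    using that by (auto simp: topspace_path_space extensional_restrict)
  have "continuous_map (prod_topology unit_interval (prod_topology T (path_space X))) X
      ((\<lambda>(g, x). a g x) \<circ> (\<lambda>z. (fst (snd z), (\<lambda>(t, f). f t) (fst z, snd (snd z)))))"
  proof (rule continuous_map_compose[OF _ X'(3)])
    have "continuous_map (prod_topology unit_interval (prod_topology T (path_space X))) X
        ((\<lambda>(t, f). f t) \<circ> (\<lambda>z. (fst z, snd (snd z))))"
      by (rule continuous_map_compose[OF _ continuous_map_path_eval])
        (intro continuous_map_pairedI continuous_map_fst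
          continuous_map_apply_snd[OF continuous_map_snd])
    then show "continuous_map (prod_topology unit_interval (prod_topology T (path_space X)))
        (prod_topology T X) (\<lambda>z. (fst (snd z), (\<lambda>(t, f). f t) (fst z, snd (snd z))))"
      unfolding o_def
      by (intro continuous_map_pairedI continuous_map_apply_snd[OF continuous_map_fst])
  qed
  from continuous_map_path_curry[OF this]
  have "continuous_map (prod_topology T (path_space X)) (path_space X) (\<lambda>(g, f). path_act a g f)"
    by (simp add: path_act_def o_def case_prod_unfold)
  moreover have "path_act a \<one>\<^bsub>G\<^esub> f = f" if "f \<in> topspace (path_space X)" for f
  proof -
    have "path_act a \<one>\<^bsub>G\<^esub> f = restrict f {0..1}"
      unfolding path_act_def by (rule restrict_ext) (use X'(1) in_X[OF that] in auto)
    then show ?thesis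
      using ext[OF that] by simp
  qed
  moreover have "path_act a (g \<otimes>\<^bsub>G\<^esub> h) f = path_act a g (path_act a h f)"
    if "g \<in> carrier G" "h \<in> carrier G" "f \<in> topspace (path_space X)" for g h f
    unfolding path_act_def by (rule restrict_ext) (use X'(2) in_X[OF that(3)] that in auto)
  moreover have "Hausdorff_space (path_space X)"
    using X by (simp add: G_space_def Hausdorff_path_space)
  ultimately show ?thesis
    using X by (simp add: G_space_iff)
qed

definition mapping_path_space ::
    "'e topology \<Rightarrow> 'b topology \<Rightarrow> ('e \<Rightarrow> 'b) \<Rightarrow> ('e \<times> (real \<Rightarrow> 'b)) topology" where
  "mapping_path_space E B p =
     subtopology (prod_topology E (path_space B)) {(e, \<beta>). \<beta> 0 = p e}"

lemma G_space_mapping_path_space: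
  assumes E: "G_space G T E aE" and B: "G_space G T B aB" and p: "G_map G E aE B aB p"
  shows "G_space G T (mapping_path_space E B p) (\<lambda>g. map_prod (aE g) (path_act aB g))"
proof -
  let ?N = "mapping_path_space E B p"
  let ?P = "path_space B"
  from E interpret topological_group G T
    by (simp add: G_space_def)
  note P = G_space_path_space[OF B]
  have "Hausdorff_space ?N"
    using E P unfolding mapping_path_space_def G_space_def
    by (intro Hausdorff_space_subtopology) (simp add: Hausdorff_space_prod_topology)
  moreover have "continuous_map (prod_topology T ?N) ?N (\<lambda>(g, z). map_prod (aE g) (path_act aB g) z)"
    unfolding mapping_path_space_def continuous_map_in_subtopology
  proof (intro conjI)
    let ?D = "prod_topology T (subtopology (prod_topology E ?P) {(e, \<beta>). \<beta> 0 = p e})"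
    have sub: "continuous_map ?D (prod_topology T (prod_topology E ?P)) id"
      by (simp add: prod_topology_subtopology(2) continuous_map_from_subtopology)
    have 1: "continuous_map (prod_topology T (prod_topology E ?P)) E
        ((\<lambda>(g, x). aE g x) \<circ> (\<lambda>z. (fst z, fst (snd z))))"
      by (rule continuous_map_compose[where X' = "prod_topology T E"])
        (use E in \<open>simp_all add: G_space_def continuous_map_pairedI continuous_map_fst
          continuous_map_apply_snd[OF continuous_map_fst]\<close>)
    have 2: "continuous_map (prod_topology T (prod_topology E ?P)) ?P
        ((\<lambda>(g, x). path_act aB g x) \<circ> (\<lambda>z. (fst z, snd (snd z))))"
      by (rule continuous_map_compose[where X' = "prod_topology T ?P"])
        (use P in \<open>simp_all add: G_space_def continuous_map_pairedI continuous_map_fst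
          continuous_map_apply_snd[OF continuous_map_snd]\<close>)
    have "continuous_map ?D (prod_topology E ?P)
       ((\<lambda>z. (((\<lambda>(g, x). aE g x) \<circ> (\<lambda>z. (fst z, fst (snd z)))) z,
              ((\<lambda>(g, x). path_act aB g x) \<circ> (\<lambda>z. (fst z, snd (snd z)))) z)) \<circ> id)"
      by (rule continuous_map_compose[OF sub]) (intro continuous_map_pairedI 1 2)
    then show "continuous_map ?D (prod_topology E ?P)
       (\<lambda>(g, z). map_prod (aE g) (path_act aB g) z)"
      by (simp add: o_def case_prod_unfold map_prod_def)
  next
    show "(\<lambda>(g, z). map_prod (aE g) (path_act aB g) z) \<in>
        topspace (prod_topology T (subtopology (prod_topology E ?P) {(e, \<beta>). \<beta> 0 = p e}))
        \<rightarrow> {(e, \<beta>). \<beta> 0 = p e}"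
      using p by (auto simp: topspace_group path_act_def G_map_def equivariant_on_def)
  qed
  moreover have "e \<in> topspace E \<and> \<beta> \<in> topspace ?P" if "(e, \<beta>) \<in> topspace ?N" for e \<beta>
    using that by (auto simp: mapping_path_space_def)
  moreover note E[unfolded G_space_iff] P[unfolded G_space_iff]
  ultimately show ?thesis
    unfolding G_space_iff by (intro conjI ballI) (simp_all add: split_paired_all)
qed

lemma G_fibration_HLP:
  assumes fib: "G_fibration G T E aE B aB p" and X: "G_space G T X aX"
  shows "G_HLP G E aE B aB p X aX"
  unfolding G_HLP_def
proof (intro allI impI, elim conjE)
  fix f H
  assume f: "G_map G X aX E aE f"
    and H: "G_map G (prod_topology unit_interval X) (\<lambda>g. map_prod id (aX g)) B aB H"
    and H0: "\<forall>x\<in>topspace X. H (0, x) = p (f x)"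
  let ?N = "mapping_path_space E B p"
  let ?aN = "\<lambda>g. map_prod (aE g) (path_act aB g)"
  let ?ev = "\<lambda>z. snd (snd z) (fst z)"
  have p: "G_map G E aE B aB p"
    and N: "G_space G T ?N ?aN"
    using fib G_space_mapping_path_space by (auto simp: G_fibration_def)
  then have HLP: "G_HLP G E aE B aB p ?N ?aN"
    using fib by (auto simp: G_fibration_def)
  have topN: "topspace ?N = {(e, \<beta>). e \<in> topspace E \<and> \<beta> \<in> topspace (path_space B) \<and> \<beta> 0 = p e}"
    by (auto simp: mapping_path_space_def)
  have "continuous_map ?N E fst"
    unfolding mapping_path_space_def
    by (intro continuous_map_from_subtopology continuous_map_fst)
  then have 1: "G_map G ?N ?aN E aE fst"
    by (auto simp: G_map_def equivariant_on_def)
  have "continuous_map ?N (path_space B) snd"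
    unfolding mapping_path_space_def
    by (intro continuous_map_from_subtopology continuous_map_snd)
  then have "continuous_map (prod_topology unit_interval ?N) B
      ((\<lambda>(t, f). f t) \<circ> (\<lambda>z. (fst z, snd (snd z))))"
    by (intro continuous_map_compose[OF _ continuous_map_path_eval] continuous_map_pairedI
        continuous_map_fst continuous_map_apply_snd)
  then have 2: "G_map G (prod_topology unit_interval ?N) (\<lambda>g. map_prod id (?aN g)) B aB ?ev"
    by (auto simp: G_map_def equivariant_on_def path_act_def o_def)
  have 3: "\<forall>z\<in>topspace ?N. ?ev (0, z) = p (fst z)"
    by (auto simp: topN)
  from HLP[unfolded G_HLP_def, rule_format, of fst ?ev] 1 2 3
  obtain L where L: "G_map G (prod_topology unit_interval ?N) (\<lambda>g. map_prod id (?aN g)) E aE L"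
    and L0: "\<And>z. z \<in> topspace ?N \<Longrightarrow> L (0, z) = fst z"
    and pL: "\<And>t z. t \<in> {0..1} \<Longrightarrow> z \<in> topspace ?N \<Longrightarrow> p (L (t, z)) = ?ev (t, z)"
    by blast
  define \<phi> where "\<phi> = (\<lambda>x. (f x, restrict (\<lambda>t. H (t, x)) {0..1}))"
  have "continuous_map X (prod_topology E (path_space B)) \<phi>"
    unfolding \<phi>_def using f H
    by (intro continuous_map_pairedI continuous_map_path_curry) (auto simp: G_map_def)
  then have \<phi>: "continuous_map X ?N \<phi>"
    using H0 by (auto simp: mapping_path_space_def continuous_map_in_subtopology \<phi>_def)
  have \<phi>N: "\<phi> x \<in> topspace ?N" if "x \<in> topspace X" for x
    using continuous_map_image_subset_topspace[OF \<phi>] that by auto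
  have \<phi>_eq: "\<phi> (aX g x) = ?aN g (\<phi> x)" if "g \<in> carrier G" "x \<in> topspace X" for g x
    using f H that
    by (auto simp: \<phi>_def G_map_def equivariant_on_def path_act_def restrict_def)
  let ?K = "\<lambda>z. L (fst z, \<phi> (snd z))"
  show "\<exists>K. G_map G (prod_topology unit_interval X) (\<lambda>g. map_prod id (aX g)) E aE K \<and>
         (\<forall>x\<in>topspace X. K (0, x) = f x) \<and>
         (\<forall>t\<in>{0..1}. \<forall>x\<in>topspace X. p (K (t, x)) = H (t, x))"
  proof (intro exI[of _ ?K] conjI ballI)
    have "continuous_map (prod_topology unit_interval X) E (L \<circ> (\<lambda>z. (fst z, \<phi> (snd z))))"
      by (rule continuous_map_compose[where X' = "prod_topology unit_interval ?N"])
        (use L in \<open>simp_all add: G_map_def continuous_map_pairedI continuous_map_fst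
          continuous_map_apply_snd[OF \<phi>]\<close>)
    then show "G_map G (prod_topology unit_interval X) (\<lambda>g. map_prod id (aX g)) E aE ?K"
      using L \<phi>N \<phi>_eq by (simp add: G_map_def equivariant_on_def o_def)
  qed (use L0 pL \<phi>N in \<open>auto simp: \<phi>_def\<close>)
qed


section \<open>Sectional category and parametrized topological complexity\<close>

definition secat ::
    "('g, 'm) monoid_scheme \<Rightarrow> 'x topology \<Rightarrow> ('g \<Rightarrow> 'x \<Rightarrow> 'x) \<Rightarrow> 'y topology \<Rightarrow> ('g \<Rightarrow> 'y \<Rightarrow> 'y)
      \<Rightarrow> ('x \<Rightarrow> 'y) \<Rightarrow> enat" where
  "secat G X aX Y aY q =
     Inf {enat k | k. 1 \<le> k \<and>
       (\<exists>U :: nat \<Rightarrow> 'y set.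
          (\<Union>i<k. U i) = topspace Y \<and>
          (\<forall>i<k. openin Y (U i) \<and> G_invariant G aY (U i) \<and>
             (\<exists>s. G_map G (subtopology Y (U i)) aY X aX s \<and>
                  G_homotopic G (subtopology Y (U i)) aY Y aY (q \<circ> s) (\<lambda>y. y))))}"

definition fibre_path_space :: "'e topology \<Rightarrow> 'b topology \<Rightarrow> ('e \<Rightarrow> 'b) \<Rightarrow> (real \<Rightarrow> 'e) topology" where
  "fibre_path_space E B p =
     subtopology (path_space E) {\<gamma>. \<exists>b\<in>topspace B. \<forall>t\<in>{0..1}. p (\<gamma> t) = b}"

text \<open>
  \<open>TC_source\<close> is $E^I_B \times_{E/G} E^I_B$, \<open>TC_target\<close> is $E \times_{B/G} E$ and \<open>TC_map\<close>
  is $\Psi$. The set of $G$-orbits is not formed; two points have the same image in the orbit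
  space iff their orbits are equal.
\<close>

definition TC_source ::
    "('g, 'm) monoid_scheme \<Rightarrow> 'e topology \<Rightarrow> ('g \<Rightarrow> 'e \<Rightarrow> 'e) \<Rightarrow> 'b topology \<Rightarrow> ('e \<Rightarrow> 'b)
      \<Rightarrow> ((real \<Rightarrow> 'e) \<times> (real \<Rightarrow> 'e)) topology" where
  "TC_source G E aE B p =
     subtopology (prod_topology (fibre_path_space E B p) (fibre_path_space E B p))
       {(\<gamma>, \<delta>). orbit G aE (\<gamma> 1) = orbit G aE (\<delta> 0)}"

definition TC_target ::
    "('g, 'm) monoid_scheme \<Rightarrow> 'e topology \<Rightarrow> ('g \<Rightarrow> 'b \<Rightarrow> 'b) \<Rightarrow> ('e \<Rightarrow> 'b) \<Rightarrow> ('e \<times> 'e) topology" where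
  "TC_target G E aB p =
     subtopology (prod_topology E E) {(e, e'). orbit G aB (p e) = orbit G aB (p e')}"

definition TC_map :: "(real \<Rightarrow> 'e) \<times> (real \<Rightarrow> 'e) \<Rightarrow> 'e \<times> 'e" where
  "TC_map = (\<lambda>(\<gamma>, \<delta>). (\<gamma> 0, \<delta> 1))"

definition TC ::
    "('g, 'm) monoid_scheme \<Rightarrow> 'e topology \<Rightarrow> ('g \<Rightarrow> 'e \<Rightarrow> 'e) \<Rightarrow> 'b topology \<Rightarrow> ('g \<Rightarrow> 'b \<Rightarrow> 'b)
      \<Rightarrow> ('e \<Rightarrow> 'b) \<Rightarrow> enat" where
  "TC G E aE B aB p =
     secat (G \<times>\<times> G)
       (TC_source G E aE B p) (prod_act (path_act aE) (path_act aE))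
       (TC_target G E aB p) (prod_act aE aE)
       TC_map"

end

theory Submission
  imports Defs
begin

text \<open>
  The inequality is the product inequality for equivariant sectional category, applied to the maps
  $\Psi_1$ and $\Psi_2$ of the two fibrations.

  The product inequality (\<open>secat_prod_le\<close>) is proved by the classical diagonal argument. Let
  $U_0, \dots, U_{k-1}$ and $V_0, \dots, V_{l-1}$ be covers of $Y$ and $Y'$ by invariant open sets
  with sections up to homotopy. The differences $A_i = U_i \setminus (U_0 \cup \dots \cup U_{i-1})$
  partition $Y$, and likewise $B_j$ partitions $Y'$. All are invariant, because the group acts by
  bijections. The $k + l - 1$ diagonals $\bigcup_{i+j=r} A_i \times B_j$ cover $Y \times Y'$. If two
  strata lie on the same diagonal, then one has the smaller first index and the other the smaller
  second index. Hence $U_i \times Y'$ and $Y \times V_j$, with the respective smaller index, are open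
  sets each of which contains one of the two strata and misses the other one, and the strata are
  separated. Equivariant complete normality thickens the strata of one diagonal to disjoint
  invariant open sets, which may be taken inside the $U_i \times V_j$
  (\<open>G_completely_normal_separated_family\<close>). On each of these the product of the two local sections
  is available, and sections over disjoint open sets glue (\<open>sectional_UN_disjoint\<close>).

  It remains to compare $\Psi$ for $p_1 \times p_2$ with $\Psi_1 \times \Psi_2$. Orbits in a product
  are products of orbits, so interchanging the two middle coordinates identifies the target of
  $\Psi$ with the product of the targets of $\Psi_1$ and $\Psi_2$; pairing paths coordinatewise
  gives a compatible map of the sources, and sections are transported along it
  (\<open>secat_transfer\<close>). The product of the targets is an invariant subspace of
  $E_1 \times E_1 \times E_2 \times E_2$ and inherits complete normality
  (\<open>G_completely_normal_embedding\<close>).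
\<close>

section \<open>Local deformed sections\<close>

definition deformed_section ::
    "('g, 'm) monoid_scheme \<Rightarrow> 'x topology \<Rightarrow> ('g \<Rightarrow> 'x \<Rightarrow> 'x) \<Rightarrow> 'y topology \<Rightarrow> ('g \<Rightarrow> 'y \<Rightarrow> 'y)
      \<Rightarrow> ('x \<Rightarrow> 'y) \<Rightarrow> 'y set \<Rightarrow> ('y \<Rightarrow> 'x) \<Rightarrow> (real \<times> 'y \<Rightarrow> 'y) \<Rightarrow> bool" where
  "deformed_section G X aX Y aY q U s h \<longleftrightarrow>
     continuous_map (subtopology Y U) X s \<and>
     equivariant_on G U aY aX s \<and>
     continuous_map (prod_topology unit_interval (subtopology Y U)) Y h \<and>
     (\<forall>t\<in>{0..1}. equivariant_on G U aY aY (\<lambda>y. h (t, y))) \<and>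
     (\<forall>y\<in>U. h (0, y) = q (s y) \<and> h (1, y) = y)"

definition sectional ::
    "('g, 'm) monoid_scheme \<Rightarrow> 'x topology \<Rightarrow> ('g \<Rightarrow> 'x \<Rightarrow> 'x) \<Rightarrow> 'y topology \<Rightarrow> ('g \<Rightarrow> 'y \<Rightarrow> 'y)
      \<Rightarrow> ('x \<Rightarrow> 'y) \<Rightarrow> 'y set \<Rightarrow> bool" where
  "sectional G X aX Y aY q U \<longleftrightarrow>
     openin Y U \<and> G_invariant G aY U \<and> (\<exists>s h. deformed_section G X aX Y aY q U s h)"

text \<open>
  The relation \<^const>\<open>G_homotopic\<close> prescribes the ends of a homotopy also outside the space,
  which is awkward for restricting and gluing. Only the values on \<open>U\<close> matter here, because
  equivariance on an invariant set depends only on the values there.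
\<close>

lemma sectional_iff_G_homotopic:
  "sectional G X aX Y aY q U \<longleftrightarrow>
     openin Y U \<and> G_invariant G aY U \<and>
     (\<exists>s. G_map G (subtopology Y U) aY X aX s \<and>
          G_homotopic G (subtopology Y U) aY Y aY (q \<circ> s) (\<lambda>y. y))"
proof (cases "openin Y U \<and> G_invariant G aY U")
  case True
  then have top: "topspace (subtopology Y U) = U"
    using openin_subset by fastforce
  have "(\<exists>h. deformed_section G X aX Y aY q U s h) \<longleftrightarrow>
      G_map G (subtopology Y U) aY X aX s \<and>
      G_homotopic G (subtopology Y U) aY Y aY (q \<circ> s) (\<lambda>y. y)" for s
  proof -
    have inv: "aY g y \<in> U" if "g \<in> carrier G" "y \<in> U" for g y
      using True that by (auto simp: G_invariant_def)
    have cong: "equivariant_on G U aY aY f \<longleftrightarrow> equivariant_on G U aY aY k"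
      if "\<And>y. y \<in> topspace (subtopology Y U) \<Longrightarrow> f y = k y" for f k
      using that inv unfolding equivariant_on_def top by auto
    have "G_homotopic G (subtopology Y U) aY Y aY (q \<circ> s) (\<lambda>y. y) \<longleftrightarrow>
      (\<exists>h. continuous_map (prod_topology unit_interval (subtopology Y U)) Y h \<and>
        (\<forall>y\<in>U. h (0, y) = (q \<circ> s) y) \<and> (\<forall>y\<in>U. h (1, y) = y) \<and>
        (\<forall>t\<in>{0..1}. equivariant_on G U aY aY (\<lambda>y. h (t, y))))"
      using homotopic_with[of "subtopology Y U" "equivariant_on G U aY aY" Y "q \<circ> s" "\<lambda>y. y", OF cong]
      unfolding G_homotopic_def top .
    then show ?thesis
      unfolding deformed_section_def G_map_def top o_def by blast
  qed
  with True show ?thesis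
    unfolding sectional_def by blast
qed (auto simp: sectional_def)

lemma secat_eq_Inf_sectional:
  "secat G X aX Y aY q =
     Inf {enat k | k. 1 \<le> k \<and>
       (\<exists>U :: nat \<Rightarrow> 'y set. (\<Union>i<k. U i) = topspace Y \<and> (\<forall>i<k. sectional G X aX Y aY q (U i)))}"
  for Y :: "'y topology"
  unfolding secat_def sectional_iff_G_homotopic ..

lemma secat_le:
  assumes "1 \<le> k" "(\<Union>i<k. U i) = topspace Y" "\<And>i. i < k \<Longrightarrow> sectional G X aX Y aY q (U i)"
  shows "secat G X aX Y aY q \<le> enat k"
  unfolding secat_eq_Inf_sectional using assms by (intro Inf_lower) blast

lemma secat_cover:
  assumes "secat G X aX Y aY q = enat k"
  obtains U where "1 \<le> k" "(\<Union>i<k. U i) = topspace Y"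
    "\<And>i. i < k \<Longrightarrow> sectional G X aX Y aY q (U i)"
proof -
  let ?S = "{enat k | k. 1 \<le> k \<and>
       (\<exists>U. (\<Union>i<k. U i) = topspace Y \<and> (\<forall>i<k. sectional G X aX Y aY q (U i)))}"
  have "?S \<noteq> {}"
    using assms unfolding secat_eq_Inf_sectional Inf_enat_def by (metis (lifting) enat.distinct(1))
  then have "Inf ?S \<in> ?S"
    by (meson equals0I wellorder_InfI)
  then have "enat k \<in> ?S"
    using assms unfolding secat_eq_Inf_sectional by simp
  then show ?thesis
    using that by auto
qed

lemma sectional_subset:
  assumes U: "sectional G X aX Y aY q U" and W: "openin Y W" "G_invariant G aY W" "W \<subseteq> U"
  shows "sectional G X aX Y aY q W"
proof -
  obtain s h where "deformed_section G X aX Y aY q U s h"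
    using U by (auto simp: sectional_def)
  moreover have "prod_topology unit_interval (subtopology Y W) =
      subtopology (prod_topology unit_interval (subtopology Y U)) (UNIV \<times> W)"
    using W(3) by (simp add: subtopology_Times subtopology_subtopology Int_absorb1)
  moreover have "subtopology Y W = subtopology (subtopology Y U) W"
    using W(3) by (simp add: subtopology_subtopology Int_absorb1)
  ultimately have "deformed_section G X aX Y aY q W s h"
    using W(3) unfolding deformed_section_def equivariant_on_def
    by (auto intro: continuous_map_from_subtopology)
  with W show ?thesis
    by (auto simp: sectional_def)
qed

text \<open>
  The pieces are open and pairwise disjoint, so choosing the data of the piece that contains the
  given point is continuous; it is equivariant because orbits stay inside a piece.
\<close>

lemma sectional_UN_disjoint:
  assumes W: "\<And>i. i \<in> I \<Longrightarrow> sectional G X aX Y aY q (W i)"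
    and disj: "\<And>i j. i \<in> I \<Longrightarrow> j \<in> I \<Longrightarrow> i \<noteq> j \<Longrightarrow> disjnt (W i) (W j)"
  shows "sectional G X aX Y aY q (\<Union>i\<in>I. W i)"
proof -
  have op: "openin Y (W i)" and inv: "G_invariant G aY (W i)" if "i \<in> I" for i
    using W[OF that] by (auto simp: sectional_def)
  have "\<exists>s h. deformed_section G X aX Y aY q (W i) s h" if "i \<in> I" for i
    using W[OF that] by (auto simp: sectional_def)
  then obtain s h where sh: "\<And>i. i \<in> I \<Longrightarrow> deformed_section G X aX Y aY q (W i) (s i) (h i)"
    by metis
  (* the index of the unique piece that contains y *)
  define j where "j y = (SOME i. i \<in> I \<and> y \<in> W i)" for y
  have j: "j y = i" if "i \<in> I" "y \<in> W i" for i y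
    unfolding j_def using that disj by (intro some_equality) (auto simp: disjnt_iff)
  let ?V = "\<Union>i\<in>I. W i"
  have V: "subtopology Y (W i) = subtopology (subtopology Y ?V) (W i)" if "i \<in> I" for i
    using that by (simp add: subtopology_subtopology SUP_upper Int_absorb1)
  have opV: "openin (subtopology Y ?V) (W i)" if "i \<in> I" for i
    using op[OF that] that by (auto simp: openin_subtopology)
  have "deformed_section G X aX Y aY q ?V (\<lambda>y. s (j y) y) (\<lambda>z. h (j (snd z)) z)"
    unfolding deformed_section_def
  proof (intro conjI ballI)
    show "continuous_map (subtopology Y ?V) X (\<lambda>y. s (j y) y)"
    proof (rule pasting_lemma[where I = I and T = W and f = s])
      show "continuous_map (subtopology (subtopology Y ?V) (W i)) X (s i)" if "i \<in> I" for i
        using sh[OF that] V[OF that] by (simp add: deformed_section_def)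
      show "s i y = s i' y"
        if "i \<in> I" "i' \<in> I" "y \<in> topspace (subtopology Y ?V) \<inter> W i \<inter> W i'" for i i' y
        using that j[of i y] j[of i' y] by simp
    qed (use opV j in auto)
    show "equivariant_on G ?V aY aX (\<lambda>y. s (j y) y)"
      using sh inv j by (fastforce simp: equivariant_on_def deformed_section_def G_invariant_def)
    show "continuous_map (prod_topology unit_interval (subtopology Y ?V)) Y (\<lambda>z. h (j (snd z)) z)"
    proof (rule pasting_lemma[where I = I and T = "\<lambda>i. {0..1} \<times> W i" and f = h])
      show "openin (prod_topology unit_interval (subtopology Y ?V)) ({0..1} \<times> W i)" if "i \<in> I" for i
        using opV[OF that] by (simp add: openin_prod_Times_iff)
      show "continuous_map (subtopology (prod_topology unit_interval (subtopology Y ?V))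
          ({0..1} \<times> W i)) Y (h i)" if "i \<in> I" for i
        using sh[OF that] V[OF that] by (simp add: deformed_section_def subtopology_Times
          subtopology_subtopology)
    qed (use j in auto)
    show "equivariant_on G ?V aY aY (\<lambda>y. h (j (snd (t, y))) (t, y))" if "t \<in> {0..1}" for t
      using sh inv j that
      by (fastforce simp: equivariant_on_def deformed_section_def G_invariant_def)
    show "h (j (snd (0, y))) (0, y) = q (s (j y) y)" "h (j (snd (1, y))) (1, y) = y"
      if "y \<in> ?V" for y
      using sh j that by (fastforce simp: deformed_section_def)+
  qed
  moreover have "openin Y ?V" "G_invariant G aY ?V"
    using op inv unfolding G_invariant_def by blast+
  ultimately show ?thesis
    by (auto simp: sectional_def)
qed

lemma sectional_Times:
  assumes U: "sectional G X aX Y aY q U" and V: "sectional H X' aX' Y' aY' q' V"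
  shows "sectional (G \<times>\<times> H) (prod_topology X X') (prod_act aX aX')
           (prod_topology Y Y') (prod_act aY aY') (map_prod q q') (U \<times> V)"
proof -
  obtain s h where s: "deformed_section G X aX Y aY q U s h"
    using U by (auto simp: sectional_def)
  obtain s' h' where s': "deformed_section H X' aX' Y' aY' q' V s' h'"
    using V by (auto simp: sectional_def)
  let ?D = "prod_topology (subtopology Y U) (subtopology Y' V)"
  let ?I = "prod_topology unit_interval ?D"
  have 1: "continuous_map ?I Y (h \<circ> (\<lambda>z. (fst z, fst (snd z))))"
    by (rule continuous_map_compose[where X' = "prod_topology unit_interval (subtopology Y U)"])
      (use s in \<open>simp_all add: deformed_section_def continuous_map_pairedI continuous_map_fst
        continuous_map_apply_snd[OF continuous_map_fst]\<close>)
  have 2: "continuous_map ?I Y' (h' \<circ> (\<lambda>z. (fst z, snd (snd z))))"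
    by (rule continuous_map_compose[where X' = "prod_topology unit_interval (subtopology Y' V)"])
      (use s' in \<open>simp_all add: deformed_section_def continuous_map_pairedI continuous_map_fst
        continuous_map_apply_snd[OF continuous_map_snd]\<close>)
  have "continuous_map ?I (prod_topology Y Y')
      (\<lambda>z. (h (fst z, fst (snd z)), h' (fst z, snd (snd z))))"
    using continuous_map_pairedI[OF 1 2] by (simp add: o_def)
  moreover have "continuous_map ?D (prod_topology X X') (map_prod s s')"
    using s s' by (simp add: deformed_section_def map_prod_def continuous_map_prod_top)
  ultimately have "deformed_section (G \<times>\<times> H) (prod_topology X X') (prod_act aX aX')
      (prod_topology Y Y') (prod_act aY aY') (map_prod q q') (U \<times> V) (map_prod s s')
      (\<lambda>z. (h (fst z, fst (snd z)), h' (fst z, snd (snd z))))"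
    using s s' by (auto simp: deformed_section_def subtopology_Times equivariant_on_def prod_act_def)
  then show ?thesis
    using U V by (auto simp: sectional_def openin_prod_Times_iff G_invariant_def prod_act_def)
qed

text \<open>
  A section \<open>s\<close> over \<open>U\<close> pulls back to the section \<open>\<theta> \<circ> s \<circ> f\<close> over the preimage of \<open>U\<close>,
  and a deformation of \<open>q \<circ> s\<close> to the inclusion is conjugated by the homeomorphism \<open>f\<close>.
  The relabelling \<open>\<phi>\<close> of group elements allows for the reordering of the factors of a product of
  groups.
\<close>

lemma secat_transfer:
  assumes k: "homeomorphic_maps Y' Y f k"
    and \<phi>: "\<And>g. g \<in> carrier G' \<Longrightarrow> \<phi> g \<in> carrier G"
    and f: "\<And>g y. g \<in> carrier G' \<Longrightarrow> y \<in> topspace Y' \<Longrightarrow> f (aY' g y) = aY (\<phi> g) (f y)"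
    and k_eq: "\<And>g y. g \<in> carrier G' \<Longrightarrow> y \<in> topspace Y \<Longrightarrow> k (aY (\<phi> g) y) = aY' g (k y)"
    and \<theta>: "continuous_map X X' \<theta>"
    and \<theta>_eq: "\<And>g x. g \<in> carrier G' \<Longrightarrow> x \<in> topspace X \<Longrightarrow> \<theta> (aX (\<phi> g) x) = aX' g (\<theta> x)"
    and q: "\<And>x. x \<in> topspace X \<Longrightarrow> q' (\<theta> x) = k (q x)"
  shows "secat G' X' aX' Y' aY' q' \<le> secat G X aX Y aY q"
proof (cases "secat G X aX Y aY q")
  case (enat n)
  then obtain U where n: "1 \<le> n" and cov: "(\<Union>i<n. U i) = topspace Y"
    and U: "\<And>i. i < n \<Longrightarrow> sectional G X aX Y aY q (U i)"
    by (rule secat_cover) blast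
  have fc: "continuous_map Y' Y f" and kc: "continuous_map Y Y' k"
    and kf: "\<And>y. y \<in> topspace Y' \<Longrightarrow> k (f y) = y"
    using k by (auto simp: homeomorphic_maps_def)
  have fY: "f y \<in> topspace Y" if "y \<in> topspace Y'" for y
    using fc that by (simp add: continuous_map_def Pi_iff)
  (* Y is invariant as a union of invariant sets, and Y' inherits this through f *)
  have inv: "G_invariant G' aY' (topspace Y')"
    unfolding G_invariant_def
  proof (intro ballI)
    fix g y assume g: "g \<in> carrier G'" and y: "y \<in> topspace Y'"
    obtain i where "i < n" "f y \<in> U i"
      using fY[OF y] cov by blast
    then have "openin Y (U i)" "aY (\<phi> g) (f y) \<in> U i"
      using U[of i] \<phi>[OF g] by (auto simp: sectional_def G_invariant_def)
    then have "aY (\<phi> g) (f y) \<in> topspace Y"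
      using openin_subset by blast
    then have "k (aY (\<phi> g) (f y)) \<in> topspace Y'"
      using kc by (auto simp: continuous_map_def Pi_iff)
    then show "aY' g y \<in> topspace Y'"
      using k_eq[OF g fY[OF y]] kf[OF y] by simp
  qed
  define V where "V i = {y \<in> topspace Y'. f y \<in> U i}" for i
  have "sectional G' X' aX' Y' aY' q' (V i)" if i: "i < n" for i
  proof -
    have op: "openin Y (U i)" and invU: "G_invariant G aY (U i)"
      using U[OF i] by (auto simp: sectional_def)
    obtain s h where sh: "deformed_section G X aX Y aY q (U i) s h"
      using U[OF i] by (auto simp: sectional_def)
    have sX: "s y \<in> topspace X" and hY: "t \<in> {0..1} \<Longrightarrow> h (t, y) \<in> topspace Y"
      if "y \<in> U i" for y and t :: real
      using sh that openin_subset[OF op]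
      by (auto simp: deformed_section_def continuous_map_def Pi_iff)
    have fV: "continuous_map (subtopology Y' (V i)) (subtopology Y (U i)) f"
      using fc by (auto simp: continuous_map_in_subtopology continuous_map_from_subtopology V_def)
    have "continuous_map (prod_topology unit_interval (subtopology Y' (V i)))
        Y (h \<circ> (\<lambda>z. (fst z, f (snd z))))"
      by (rule continuous_map_compose[where X' = "prod_topology unit_interval (subtopology Y (U i))"])
        (use sh in \<open>simp_all add: deformed_section_def continuous_map_pairedI continuous_map_fst
          continuous_map_apply_snd[OF fV]\<close>)
    then have hc: "continuous_map (prod_topology unit_interval (subtopology Y' (V i)))
        Y' (k \<circ> (h \<circ> (\<lambda>z. (fst z, f (snd z)))))"
      using kc by (rule continuous_map_compose)
    have sc: "continuous_map (subtopology Y' (V i)) X' (\<theta> \<circ> (s \<circ> f))"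
      using fV sh \<theta> by (auto simp: deformed_section_def intro!: continuous_map_compose)
    have "deformed_section G' X' aX' Y' aY' q' (V i) (\<theta> \<circ> (s \<circ> f))
        (k \<circ> (h \<circ> (\<lambda>z. (fst z, f (snd z)))))"
      unfolding deformed_section_def
      using hc sc sh \<phi> f k_eq \<theta>_eq q sX hY kf invU
      by (auto simp: deformed_section_def equivariant_on_def V_def G_invariant_def)
    moreover have "openin Y' (V i)"
      unfolding V_def by (rule openin_continuous_map_preimage[OF fc op])
    moreover have "G_invariant G' aY' (V i)"
      using inv invU f \<phi> by (auto simp: G_invariant_def V_def)
    ultimately show ?thesis
      by (auto simp: sectional_def)
  qed
  moreover have "(\<Union>i<n. V i) = topspace Y'"
    using cov continuous_map_image_subset_topspace[OF fc] by (fastforce simp: V_def)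
  ultimately show ?thesis
    unfolding enat using n by (intro secat_le) auto
qed simp


section \<open>Separating invariant sets\<close>

lemma G_invariant_Diff:
  assumes "group G"
    and undo: "\<And>g y. g \<in> carrier G \<Longrightarrow> y \<in> topspace Y \<Longrightarrow> a (inv\<^bsub>G\<^esub> g) (a g y) = y"
    and "G_invariant G a A" "G_invariant G a B" "A \<subseteq> topspace Y"
  shows "G_invariant G a (A - B)"
  unfolding G_invariant_def
proof (intro ballI DiffI)
  fix g y assume g: "g \<in> carrier G" and y: "y \<in> A - B"
  show "a g y \<in> A"
    using assms g y by (auto simp: G_invariant_def)
  show "a g y \<notin> B"
  proof
    assume "a g y \<in> B"
    then have "a (inv\<^bsub>G\<^esub> g) (a g y) \<in> B"
      using assms g by (auto simp: G_invariant_def)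
    then show False
      using undo[OF g] y assms(5) by auto
  qed
qed

lemma separatedin_if_open_separated:
  assumes "S \<subseteq> topspace X" "T \<subseteq> topspace X"
    and "openin X P" "S \<subseteq> P" "P \<inter> T = {}" and "openin X Q" "T \<subseteq> Q" "Q \<inter> S = {}"
  shows "separatedin X S T"
proof -
  have "P \<inter> X closure_of T = {}" "Q \<inter> X closure_of S = {}"
    using assms by (simp_all add: openin_Int_closure_of_eq_empty)
  with assms show ?thesis
    by (auto simp: separatedin_def)
qed

text \<open>
  Invariant sets that are separated in a subspace are separated in the ambient space, where they
  are still invariant; the open sets that separate them there are intersected with the subspace.
  This is why complete normality, unlike normality, passes to arbitrary invariant subspaces.
\<close>

lemma G_completely_normal_embedding:
  assumes Z: "G_completely_normal H Z b"
    and emb: "embedding_map Y Z f"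
    and \<phi>: "\<phi> ` carrier G = carrier H"
    and f: "\<And>g y. g \<in> carrier G \<Longrightarrow> y \<in> topspace Y \<Longrightarrow> f (a g y) = b (\<phi> g) (f y)"
    and inv: "G_invariant G a (topspace Y)"
  shows "G_completely_normal G Y a"
  unfolding G_completely_normal_def
proof (intro allI impI, elim conjE)
  fix A A' assume A: "G_invariant G a A" and A': "G_invariant G a A'" and sep: "separatedin Y A A'"
  then have sub: "A \<subseteq> topspace Y" "A' \<subseteq> topspace Y"
    by (auto simp: separatedin_def)
  let ?Z = "subtopology Z (f ` topspace Y)"
  have hom: "homeomorphic_map Y ?Z f"
    using emb by (simp add: embedding_map_def)
  then have inj: "inj_on f (topspace Y)" and fc: "continuous_map Y Z f"
    by (auto simp: homeomorphic_eq_everything_map continuous_map_in_subtopology)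
  have disj: "f ` C \<inter> f ` D = {}"
    if "C \<inter> D = {}" "C \<subseteq> topspace Y" "D \<subseteq> topspace Y" for C D
    using inj_on_image_Int[OF inj that(2,3)] that(1) by simp
  have "f ` A \<inter> f ` (Y closure_of A') = {}" "f ` (Y closure_of A) \<inter> f ` A' = {}"
    using sep by (intro disj sub closure_of_subset_topspace; simp add: separatedin_def Int_commute)+
  moreover have "f ` A \<subseteq> topspace ?Z" "f ` A' \<subseteq> topspace ?Z"
    using sub continuous_map_image_subset_topspace[OF fc] by auto
  ultimately have "separatedin ?Z (f ` A) (f ` A')"
    using homeomorphic_map_closure_of[OF hom sub(1)] homeomorphic_map_closure_of[OF hom sub(2)]
    by (simp add: separatedin_def Int_commute)
  then have "separatedin Z (f ` A) (f ` A')"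
    by (simp add: separatedin_subtopology)
  moreover have "G_invariant H b (f ` C)" if C: "G_invariant G a C" "C \<subseteq> topspace Y" for C
    unfolding G_invariant_def \<phi>[symmetric]
    using that f by (auto simp: G_invariant_def) (metis imageI subsetD)
  ultimately obtain U U' where U: "openin Z U" "openin Z U'" "G_invariant H b U"
    "G_invariant H b U'" "f ` A \<subseteq> U" "f ` A' \<subseteq> U'" "disjnt U U'"
    using Z A A' sub unfolding G_completely_normal_def by metis
  have pre: "G_invariant G a {y \<in> topspace Y. f y \<in> C}" if "G_invariant H b C" for C
    unfolding G_invariant_def
  proof (intro ballI CollectI conjI; elim CollectE conjE)
    fix g y assume g: "g \<in> carrier G" and y: "y \<in> topspace Y" "f y \<in> C"
    show "a g y \<in> topspace Y"
      using inv g y(1) by (simp add: G_invariant_def)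
    have "\<phi> g \<in> carrier H"
      using \<phi> g by blast
    then show "f (a g y) \<in> C"
      using that y(2) f[OF g y(1)] by (simp add: G_invariant_def)
  qed
  show "\<exists>U U'. openin Y U \<and> openin Y U' \<and> G_invariant G a U \<and> G_invariant G a U' \<and>
                A \<subseteq> U \<and> A' \<subseteq> U' \<and> disjnt U U'"
    using U sub pre[OF U(3)] pre[OF U(4)] openin_continuous_map_preimage[OF fc]
    by (intro exI[of _ "{y \<in> topspace Y. f y \<in> U}"] exI[of _ "{y \<in> topspace Y. f y \<in> U'}"])
      (auto simp: disjnt_iff)
qed

text \<open>
  Complete normality separates each member from the union of the others, by \<open>P i\<close> and \<open>Q i\<close>.
  Intersecting \<open>P i\<close> with all \<open>Q j\<close> for \<open>j \<noteq> i\<close> makes these neighbourhoods disjoint.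
\<close>

lemma G_completely_normal_separated_family:
  assumes X: "G_completely_normal G X a" and I: "finite I"
    and inv: "\<And>i. i \<in> I \<Longrightarrow> G_invariant G a (S i)"
    and sub: "\<And>i. i \<in> I \<Longrightarrow> S i \<subseteq> topspace X"
    and sep: "\<And>i j. i \<in> I \<Longrightarrow> j \<in> I \<Longrightarrow> i \<noteq> j \<Longrightarrow> separatedin X (S i) (S j)"
  obtains W where "\<And>i. i \<in> I \<Longrightarrow> openin X (W i)" "\<And>i. i \<in> I \<Longrightarrow> G_invariant G a (W i)"
    "\<And>i. i \<in> I \<Longrightarrow> S i \<subseteq> W i"
    "\<And>i j. i \<in> I \<Longrightarrow> j \<in> I \<Longrightarrow> i \<noteq> j \<Longrightarrow> disjnt (W i) (W j)"
proof -
  have "\<exists>P Q. openin X P \<and> openin X Q \<and> G_invariant G a P \<and> G_invariant G a Q \<and>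
      S i \<subseteq> P \<and> (\<Union>j\<in>I - {i}. S j) \<subseteq> Q \<and> disjnt P Q" if i: "i \<in> I" for i
  proof -
    have "separatedin X (S i) (\<Union>j\<in>I - {i}. S j)"
      using I i sub sep by (subst separatedin_Union) auto
    moreover have "G_invariant G a (\<Union>j\<in>I - {i}. S j)"
      using inv by (fastforce simp: G_invariant_def)
    ultimately show ?thesis
      using X inv[OF i] unfolding G_completely_normal_def by blast
  qed
  then obtain P Q where P: "\<And>i. i \<in> I \<Longrightarrow> openin X (P i) \<and> G_invariant G a (P i) \<and> S i \<subseteq> P i"
    and Q: "\<And>i. i \<in> I \<Longrightarrow> openin X (Q i) \<and> G_invariant G a (Q i) \<and> (\<Union>j\<in>I - {i}. S j) \<subseteq> Q i"
    and PQ: "\<And>i. i \<in> I \<Longrightarrow> disjnt (P i) (Q i)"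
    by metis
  define W where "W i = P i \<inter> (\<Inter>j\<in>I - {i}. Q j \<inter> topspace X)" for i
  show ?thesis
  proof (rule that[of W])
    fix i assume i: "i \<in> I"
    show "openin X (W i)"
    proof (cases "I - {i} = {}")
      case False
      then show ?thesis
        unfolding W_def using I i P Q by (intro openin_Int openin_INT2) auto
    qed (use P i in \<open>auto simp: W_def\<close>)
    have QX: "Q j \<inter> topspace X = Q j" if "j \<in> I" for j
      using Q[OF that] openin_subset by blast
    show "G_invariant G a (W i)"
      using P Q i QX by (auto simp: W_def G_invariant_def)
    show "S i \<subseteq> W i"
    proof -
      have "S i \<subseteq> Q j \<inter> topspace X" if "j \<in> I - {i}" for j
        using Q[of j] QX[of j] i that by blast
      then show ?thesis
        using P[OF i] by (auto simp: W_def)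
    qed
  next
    fix i j assume "i \<in> I" "j \<in> I" "i \<noteq> j"
    then show "disjnt (W i) (W j)"
      using PQ[of i] by (auto simp: W_def disjnt_iff)
  qed
qed


section \<open>Sectional category of a product\<close>

lemma G_invariant_disjointed:
  assumes "group G"
    and "\<And>g y. g \<in> carrier G \<Longrightarrow> y \<in> topspace Y \<Longrightarrow> a (inv\<^bsub>G\<^esub> g) (a g y) = y"
    and "\<And>i. i < k \<Longrightarrow> openin Y (U i) \<and> G_invariant G a (U i)" and "i < k"
  shows "G_invariant G a (disjointed U i)"
  unfolding disjointed_def
proof (rule G_invariant_Diff)
  show "G_invariant G a (\<Union>i\<in>{0..<i}. U i)"
    unfolding G_invariant_def
  proof (intro ballI)
    fix g y assume "g \<in> carrier G" "y \<in> (\<Union>i\<in>{0..<i}. U i)"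
    then obtain n where "n < i" "y \<in> U n"
      by auto
    then have "a g y \<in> U n"
      using assms(3)[of n] assms(4) \<open>g \<in> carrier G\<close> by (auto simp: G_invariant_def)
    with \<open>n < i\<close> show "a g y \<in> (\<Union>i\<in>{0..<i}. U i)"
      by auto
  qed
  show "U i \<subseteq> topspace Y"
    using assms(3,4) openin_subset by blast
qed (use assms in auto)

text \<open>
  The hypotheses on inverses hold for every \<open>G\<close>-space. They make the differences of consecutive
  members of a cover invariant.
\<close>

theorem secat_prod_le:
  assumes G: "group G" and H: "group H"
    and undo: "\<And>g y. g \<in> carrier G \<Longrightarrow> y \<in> topspace Y \<Longrightarrow> aY (inv\<^bsub>G\<^esub> g) (aY g y) = y"
    and undo': "\<And>g y. g \<in> carrier H \<Longrightarrow> y \<in> topspace Y' \<Longrightarrow> aY' (inv\<^bsub>H\<^esub> g) (aY' g y) = y"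
    and normal: "G_completely_normal (G \<times>\<times> H) (prod_topology Y Y') (prod_act aY aY')"
  shows "secat (G \<times>\<times> H) (prod_topology X X') (prod_act aX aX')
           (prod_topology Y Y') (prod_act aY aY') (map_prod q q')
         \<le> secat G X aX Y aY q + secat H X' aX' Y' aY' q' - 1"
    (is "?L \<le> ?R")
proof (cases "secat G X aX Y aY q = \<infinity> \<or> secat H X' aX' Y' aY' q' = \<infinity>")
  case False
  then obtain k l where k: "secat G X aX Y aY q = enat k" and l: "secat H X' aX' Y' aY' q' = enat l"
    by auto
  obtain U where k1: "1 \<le> k" and covU: "(\<Union>i<k. U i) = topspace Y"
    and U: "\<And>i. i < k \<Longrightarrow> sectional G X aX Y aY q (U i)"
    using k by (rule secat_cover) blast
  obtain V where l1: "1 \<le> l" and covV: "(\<Union>i<l. V i) = topspace Y'"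
    and V: "\<And>i. i < l \<Longrightarrow> sectional H X' aX' Y' aY' q' (V i)"
    using l by (rule secat_cover) blast
  have opU: "openin Y (U i) \<and> G_invariant G aY (U i)" if "i < k" for i
    using U[OF that] by (auto simp: sectional_def)
  have opV: "openin Y' (V i) \<and> G_invariant H aY' (V i)" if "i < l" for i
    using V[OF that] by (auto simp: sectional_def)
  note invA = G_invariant_disjointed[of G Y aY k U, OF G undo opU]
  note invB = G_invariant_disjointed[of H Y' aY' l V, OF H undo' opV]
  let ?YY = "prod_topology Y Y'"
  let ?sec = "sectional (G \<times>\<times> H) (prod_topology X X') (prod_act aX aX')
           (prod_topology Y Y') (prod_act aY aY') (map_prod q q')"
  (* the strata of the r-th diagonal i + j = r, indexed by the first coordinate *)
  define S where "S r i = disjointed U i \<times> disjointed V (r - i)" for r i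
  define I where "I r = {i. i < k \<and> i \<le> r \<and> r - i < l}" for r
  have "\<exists>C. ?sec C \<and> (\<forall>i\<in>I r. S r i \<subseteq> C)" for r
  proof -
    have subUV: "S r i \<subseteq> U i \<times> V (r - i)" for i
      using disjointed_subset[of U] disjointed_subset[of V] by (auto simp: S_def)
    have top: "U i \<subseteq> topspace Y" "V (r - i) \<subseteq> topspace Y'" if "i \<in> I r" for i
      using that opU[of i] opV[of "r - i"] openin_subset[of Y] openin_subset[of Y']
      by (auto simp: I_def)
    have fin: "finite (I r)"
      unfolding I_def by (rule finite_subset[of _ "{..<k}"]) auto
    have inv: "G_invariant (G \<times>\<times> H) (prod_act aY aY') (S r i)" if "i \<in> I r" for i
      using invA[of i] invB[of "r - i"] that
      by (auto simp: S_def I_def G_invariant_def prod_act_def)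
    have sub: "S r i \<subseteq> topspace ?YY" if "i \<in> I r" for i
      using subUV[of i] top[OF that] by auto
    have sep_less: "separatedin ?YY (S r i) (S r j)"
      if i: "i \<in> I r" and j: "j \<in> I r" and less: "i < j" for i j
    proof (rule separatedin_if_open_separated)
      show "openin ?YY (U i \<times> topspace Y')" "openin ?YY (topspace Y \<times> V (r - j))"
        using i j opU opV by (auto simp: I_def openin_prod_Times_iff)
      show "S r i \<subseteq> U i \<times> topspace Y'" "S r j \<subseteq> topspace Y \<times> V (r - j)"
        using subUV[of i] subUV[of j] top[OF i] top[OF j] by auto
      show "U i \<times> topspace Y' \<inter> S r j = {}"
        using less by (auto simp: S_def disjointed_def)
      have "r - j < r - i"
        using i j less by (auto simp: I_def)
      then show "topspace Y \<times> V (r - j) \<inter> S r i = {}"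
        by (auto simp: S_def disjointed_def)
    qed (use sub i j in auto)
    have sep: "separatedin ?YY (S r i) (S r j)" if "i \<in> I r" "j \<in> I r" "i \<noteq> j" for i j
      using sep_less[of i j] sep_less[of j i] that by (metis linorder_neqE_nat separatedin_sym)
    obtain W where W: "\<And>i. i \<in> I r \<Longrightarrow> openin ?YY (W i)"
      "\<And>i. i \<in> I r \<Longrightarrow> G_invariant (G \<times>\<times> H) (prod_act aY aY') (W i)"
      "\<And>i. i \<in> I r \<Longrightarrow> S r i \<subseteq> W i"
      "\<And>i j. i \<in> I r \<Longrightarrow> j \<in> I r \<Longrightarrow> i \<noteq> j \<Longrightarrow> disjnt (W i) (W j)"
      by (rule G_completely_normal_separated_family[where S = "S r", OF normal fin inv sub sep])
        (assumption | rule that)+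
    let ?W = "\<lambda>i. W i \<inter> (U i \<times> V (r - i))"
    have sec: "?sec (U i \<times> V (r - i))" if "i \<in> I r" for i
      using that U V by (intro sectional_Times) (auto simp: I_def)
    have "?sec (?W i)" if i: "i \<in> I r" for i
    proof (rule sectional_subset[OF sec[OF i]])
      show "openin ?YY (?W i)"
        using W(1)[OF i] sec[OF i] by (auto simp: sectional_def)
      show "G_invariant (G \<times>\<times> H) (prod_act aY aY') (?W i)"
        using W(2)[OF i] sec[OF i] by (auto simp: sectional_def G_invariant_def)
    qed auto
    then have "?sec (\<Union>i\<in>I r. ?W i)"
      using W(4) by (intro sectional_UN_disjoint) (auto simp: disjnt_iff)
    moreover have "S r i \<subseteq> (\<Union>i\<in>I r. ?W i)" if "i \<in> I r" for i
      using W(3)[OF that] subUV[of i] that by blast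
    ultimately show ?thesis
      by blast
  qed
  then obtain C where C: "\<And>r. ?sec (C r)" and SC: "\<And>r i. i \<in> I r \<Longrightarrow> S r i \<subseteq> C r"
    by metis
  have "(\<Union>r<k + l - 1. C r) = topspace ?YY"
  proof
    show "(\<Union>r<k + l - 1. C r) \<subseteq> topspace ?YY"
      using C openin_subset unfolding sectional_def by blast
    show "topspace ?YY \<subseteq> (\<Union>r<k + l - 1. C r)"
    proof
      fix z assume "z \<in> topspace ?YY"
      then obtain y y' where z: "z = (y, y')" "y \<in> (\<Union>i\<in>{0..<k}. disjointed U i)"
        "y' \<in> (\<Union>i\<in>{0..<l}. disjointed V i)"
        unfolding finite_UN_disjointed_eq using covU covV by (auto simp: atLeast0LessThan)
      then obtain i j where ij: "i < k" "j < l" "y \<in> disjointed U i" "y' \<in> disjointed V j"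
        by auto
      then have "i \<in> I (i + j)" "z \<in> S (i + j) i"
        using z by (auto simp: I_def S_def)
      then have "z \<in> C (i + j)"
        using SC by blast
      moreover have "i + j < k + l - 1"
        using ij by auto
      ultimately show "z \<in> (\<Union>r<k + l - 1. C r)"
        by blast
    qed
  qed
  then have "?L \<le> enat (k + l - 1)"
    using k1 C by (intro secat_le) (use l1 in auto)
  then show ?thesis
    by (simp add: k l one_enat_def)
qed auto


section \<open>Products of parametrized path spaces\<close>

definition path_pair :: "(real \<Rightarrow> 'x) \<Rightarrow> (real \<Rightarrow> 'y) \<Rightarrow> real \<Rightarrow> 'x \<times> 'y" where
  "path_pair \<gamma> \<delta> = restrict (\<lambda>t. (\<gamma> t, \<delta> t)) {0..1}"

text \<open>
  By the exponential law it suffices that the two evaluations are jointly continuous.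
\<close>

lemma continuous_map_path_pair:
  "continuous_map (prod_topology (path_space X) (path_space Y)) (path_space (prod_topology X Y))
     (\<lambda>(\<gamma>, \<delta>). path_pair \<gamma> \<delta>)"
proof -
  let ?P = "prod_topology unit_interval (prod_topology (path_space X) (path_space Y))"
  have "continuous_map ?P X ((\<lambda>(t, f). f t) \<circ> (\<lambda>z. (fst z, fst (snd z))))"
    by (intro continuous_map_compose[OF _ continuous_map_path_eval] continuous_map_pairedI
        continuous_map_fst continuous_map_apply_snd[OF continuous_map_fst])
  moreover have "continuous_map ?P Y ((\<lambda>(t, f). f t) \<circ> (\<lambda>z. (fst z, snd (snd z))))"
    by (intro continuous_map_compose[OF _ continuous_map_path_eval] continuous_map_pairedI
        continuous_map_fst continuous_map_apply_snd[OF continuous_map_snd])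
  ultimately have "continuous_map ?P (prod_topology X Y)
      (\<lambda>z. (fst (snd z) (fst z), snd (snd z) (fst z)))"
    by (simp add: continuous_map_pairwise o_def)
  from continuous_map_path_curry[OF this] show ?thesis
    by (simp add: path_pair_def case_prod_unfold)
qed

lemma prod_act_apply: "prod_act a b (g, h) (x, y) = (a g x, b h y)"
  by (simp add: prod_act_def)

lemma path_act_path_pair:
  "path_act (prod_act a b) (g, h) (path_pair \<gamma> \<delta>) = path_pair (path_act a g \<gamma>) (path_act b h \<delta>)"
  by (auto simp: path_act_def path_pair_def prod_act_def restrict_def)

lemma orbit_prod_act:
  "orbit (G \<times>\<times> H) (prod_act a b) (x, y) = orbit G a x \<times> orbit H b y"
  by (auto simp: orbit_def prod_act_def)

lemma orbit_nonempty:
  assumes "group G"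
  shows "orbit G a x \<noteq> {}"
  using group.is_monoid[OF assms] monoid.one_closed by (fastforce simp: orbit_def)

lemma fibre_path_space_path_pair:
  assumes "\<gamma> \<in> topspace (fibre_path_space E B p)" "\<delta> \<in> topspace (fibre_path_space E' B' p')"
  shows "path_pair \<gamma> \<delta> \<in> {\<gamma>. \<exists>b\<in>topspace (prod_topology B B'). \<forall>t\<in>{0..1}. map_prod p p' (\<gamma> t) = b}"
  using assms by (auto simp: fibre_path_space_def path_pair_def)

lemma continuous_map_fibre_path_pair:
  "continuous_map (prod_topology (fibre_path_space E B p) (fibre_path_space E' B' p'))
     (fibre_path_space (prod_topology E E') (prod_topology B B') (map_prod p p'))
     (\<lambda>(\<gamma>, \<delta>). path_pair \<gamma> \<delta>)"
proof -
  have "continuous_map (prod_topology (fibre_path_space E B p) (fibre_path_space E' B' p'))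
      (path_space (prod_topology E E')) (\<lambda>(\<gamma>, \<delta>). path_pair \<gamma> \<delta>)"
    using continuous_map_path_pair unfolding fibre_path_space_def subtopology_Times[symmetric]
    by (rule continuous_map_from_subtopology)
  then show ?thesis
    using fibre_path_space_path_pair[of _ E B p _ E' B' p']
    by (subst (3) fibre_path_space_def) (auto simp: continuous_map_in_subtopology)
qed

definition swap_middle :: "('a \<times> 'b) \<times> ('c \<times> 'd) \<Rightarrow> ('a \<times> 'c) \<times> ('b \<times> 'd)" where
  "swap_middle = (\<lambda>((a, b), (c, d)). ((a, c), (b, d)))"

lemma continuous_map_swap_middle:
  "continuous_map (prod_topology (prod_topology A B) (prod_topology C D))
     (prod_topology (prod_topology A C) (prod_topology B D)) swap_middle"
  unfolding swap_middle_def case_prod_unfold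
  by (intro continuous_map_pairedI continuous_map_apply_snd continuous_map_fst continuous_map_snd
      continuous_map_compose[OF continuous_map_fst, unfolded o_def])

lemma swap_middle_swap_middle [simp]: "swap_middle (swap_middle x) = x"
  by (auto simp: swap_middle_def split: prod.splits)

lemma swap_middle_prod_act:
  "swap_middle (prod_act (prod_act a b) (prod_act c d) g x) =
     prod_act (prod_act a c) (prod_act b d) (swap_middle g) (swap_middle x)"
  by (auto simp: swap_middle_def prod_act_def split: prod.splits)

definition reassoc :: "('a \<times> 'b) \<times> 'c \<Rightarrow> 'a \<times> 'b \<times> 'c" where
  "reassoc = (\<lambda>((a, b), c). (a, b, c))"

lemma homeomorphic_map_reassoc:
  "homeomorphic_map (prod_topology (prod_topology A B) C) (prod_topology A (prod_topology B C)) reassoc"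
proof -
  have "homeomorphic_maps (prod_topology (prod_topology A B) C) (prod_topology A (prod_topology B C))
      reassoc (\<lambda>(a, b, c). ((a, b), c))"
    unfolding homeomorphic_maps_def reassoc_def case_prod_unfold
    by (auto intro!: continuous_map_pairedI continuous_map_apply_snd continuous_map_fst
        continuous_map_snd continuous_map_compose[OF continuous_map_fst, unfolded o_def])
  then show ?thesis
    using homeomorphic_map_maps by blast
qed


section \<open>Parametrized topological complexity\<close>

lemma G_space_inv_undo:
  assumes "G_space G T X a" "g \<in> carrier G" "x \<in> topspace X"
  shows "a (inv\<^bsub>G\<^esub> g) (a g x) = x"
proof -
  have "group G"
    using assms(1) by (simp add: G_space_def topological_group_def)
  then have "inv\<^bsub>G\<^esub> g \<in> carrier G" "inv\<^bsub>G\<^esub> g \<otimes>\<^bsub>G\<^esub> g = \<one>\<^bsub>G\<^esub>"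
    using assms(2) by (simp_all add: group.l_inv)
  then show ?thesis
    using assms unfolding G_space_iff by metis
qed

text \<open>
  One inclusion is associativity of the action; the other is the same inclusion for the inverse
  of \<open>g\<close>, applied at \<open>a g x\<close>.
\<close>

lemma orbit_act:
  assumes X: "G_space G T X a" and g: "g \<in> carrier G" and x: "x \<in> topspace X"
  shows "orbit G a (a g x) = orbit G a x"
proof -
  have G: "group G"
    using X by (simp add: G_space_def topological_group_def)
  have sub: "orbit G a (a h y) \<subseteq> orbit G a y" if "h \<in> carrier G" "y \<in> topspace X" for h y
  proof
    fix z assume "z \<in> orbit G a (a h y)"
    then obtain k where "k \<in> carrier G" "z = a k (a h y)"
      by (auto simp: orbit_def)
    then have "z = a (k \<otimes>\<^bsub>G\<^esub> h) y" "k \<otimes>\<^bsub>G\<^esub> h \<in> carrier G"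
      using X that G by (auto simp: G_space_iff group.is_monoid monoid.m_closed)
    then show "z \<in> orbit G a y"
      by (auto simp: orbit_def)
  qed
  have "orbit G a x \<subseteq> orbit G a (a g x)"
    using sub[of "inv\<^bsub>G\<^esub> g" "a g x"] G g G_space_inv_undo[OF X g x] G_space_closed[OF X g x]
    by simp
  with sub[OF g x] show ?thesis
    by blast
qed

lemma topspace_TC_target:
  "topspace (TC_target G E aB p) =
     {(e, e'). e \<in> topspace E \<and> e' \<in> topspace E \<and> orbit G aB (p e) = orbit G aB (p e')}"
  by (auto simp: TC_target_def)

lemma G_invariant_TC_target:
  assumes E: "G_space G T E aE" and B: "G_space G T B aB" and p: "G_map G E aE B aB p"
  shows "G_invariant (G \<times>\<times> G) (prod_act aE aE) (topspace (TC_target G E aB p))"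
proof -
  have "orbit G aB (p (aE g e)) = orbit G aB (p e)" if "g \<in> carrier G" "e \<in> topspace E" for g e
    using orbit_act[OF B that(1)] p that
    by (auto simp: G_map_def equivariant_on_def continuous_map_def Pi_iff)
  then show ?thesis
    using G_space_closed[OF E] by (auto simp: G_invariant_def topspace_TC_target prod_act_def)
qed

text \<open>
  A product of nonempty sets determines its factors. This makes the conditions on orbits in
  \<^const>\<open>TC_source\<close> and \<^const>\<open>TC_target\<close> for a product of fibrations split into those for the
  factors.
\<close>

lemma orbit_prod_act_eq_iff:
  assumes "group G" "group H"
  shows "orbit (G \<times>\<times> H) (prod_act a b) z = orbit (G \<times>\<times> H) (prod_act a b) z' \<longleftrightarrow>
     orbit G a (fst z) = orbit G a (fst z') \<and> orbit H b (snd z) = orbit H b (snd z')"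
  by (cases z; cases z') (use assms in \<open>auto simp: orbit_prod_act times_eq_iff orbit_nonempty\<close>)

lemma homeomorphic_maps_TC_target_prod:
  assumes "group G" "group H"
  shows "homeomorphic_maps
     (TC_target (G \<times>\<times> H) (prod_topology E E') (prod_act b b') (map_prod p p'))
     (prod_topology (TC_target G E b p) (TC_target H E' b' p')) swap_middle swap_middle"
  unfolding homeomorphic_maps_def
proof (intro conjI ballI)
  show "continuous_map (TC_target (G \<times>\<times> H) (prod_topology E E') (prod_act b b') (map_prod p p'))
     (prod_topology (TC_target G E b p) (TC_target H E' b' p')) swap_middle"
    unfolding TC_target_def subtopology_Times[symmetric] continuous_map_in_subtopology
    by (auto intro!: continuous_map_from_subtopology continuous_map_swap_middle
        simp: orbit_prod_act_eq_iff[OF assms]) (auto simp: swap_middle_def)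
  show "continuous_map (prod_topology (TC_target G E b p) (TC_target H E' b' p'))
     (TC_target (G \<times>\<times> H) (prod_topology E E') (prod_act b b') (map_prod p p')) swap_middle"
    unfolding TC_target_def subtopology_Times[symmetric] continuous_map_in_subtopology
    by (auto intro!: continuous_map_from_subtopology continuous_map_swap_middle
        simp: orbit_prod_act_eq_iff[OF assms]) (auto simp: swap_middle_def orbit_prod_act)
qed (auto simp: swap_middle_def)

text \<open>
  The comparison of the sources that covers the homeomorphism \<open>swap_middle\<close> of the targets.
\<close>

definition TC_source_pair ::
    "((real \<Rightarrow> 'x) \<times> (real \<Rightarrow> 'x)) \<times> ((real \<Rightarrow> 'y) \<times> (real \<Rightarrow> 'y))
      \<Rightarrow> (real \<Rightarrow> 'x \<times> 'y) \<times> (real \<Rightarrow> 'x \<times> 'y)" where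
  "TC_source_pair = (\<lambda>((\<gamma>, \<delta>), (\<gamma>', \<delta>')). (path_pair \<gamma> \<gamma>', path_pair \<delta> \<delta>'))"

lemma TC_source_pair_act:
  "TC_source_pair (prod_act (prod_act (path_act a) (path_act a)) (prod_act (path_act b) (path_act b))
       (swap_middle g) x) =
     prod_act (path_act (prod_act a b)) (path_act (prod_act a b)) g (TC_source_pair x)"
proof -
  obtain g1 g2 g3 g4 \<gamma> \<delta> \<gamma>' \<delta>' where "g = ((g1, g2), (g3, g4))" "x = ((\<gamma>, \<delta>), (\<gamma>', \<delta>'))"
    by (metis surj_pair)
  then show ?thesis
    by (simp add: TC_source_pair_def swap_middle_def prod_act_apply path_act_path_pair)
qed

lemma TC_map_TC_source_pair:
  "TC_map (TC_source_pair x) = swap_middle (map_prod TC_map TC_map x)"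
  by (auto simp: TC_map_def TC_source_pair_def path_pair_def swap_middle_def split: prod.splits)

lemma continuous_map_TC_source_pair:
  assumes "group G" "group H"
  shows "continuous_map (prod_topology (TC_source G E a B p) (TC_source H E' a' B' p'))
     (TC_source (G \<times>\<times> H) (prod_topology E E') (prod_act a a') (prod_topology B B') (map_prod p p'))
     TC_source_pair"
proof -
  let ?F = "fibre_path_space E B p" and ?F' = "fibre_path_space E' B' p'"
  let ?PP = "fibre_path_space (prod_topology E E') (prod_topology B B') (map_prod p p')"
  let ?pp = "\<lambda>(\<gamma>, \<delta>). path_pair \<gamma> \<delta>"
  have "continuous_map (prod_topology (prod_topology ?F ?F') (prod_topology ?F ?F'))
      (prod_topology ?PP ?PP) (\<lambda>(x, y). (?pp x, ?pp y))"
    by (simp only: continuous_map_prod_top continuous_map_fibre_path_pair simp_thms)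
  from continuous_map_compose[OF continuous_map_swap_middle this]
  have "continuous_map (prod_topology (prod_topology ?F ?F) (prod_topology ?F' ?F'))
      (prod_topology ?PP ?PP) TC_source_pair"
    by (simp add: o_def TC_source_pair_def swap_middle_def case_prod_unfold)
  then show ?thesis
    unfolding TC_source_def subtopology_Times[symmetric] continuous_map_in_subtopology
    by (intro conjI continuous_map_from_subtopology)
      (auto simp: orbit_prod_act_eq_iff[OF assms] TC_source_pair_def path_pair_def)
qed

text \<open>
  The product inequality for $\Psi_1$ and $\Psi_2$, transported along \<open>swap_middle\<close>.
\<close>

lemma TC_prod_le:
  assumes E1: "G_space G1 T1 E1 a1" and B1: "G_space G1 T1 B1 b1" and p1: "G_map G1 E1 a1 B1 b1 p1"
    and E2: "G_space G2 T2 E2 a2" and B2: "G_space G2 T2 B2 b2" and p2: "G_map G2 E2 a2 B2 b2 p2"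
    and cn: "G_completely_normal (G1 \<times>\<times> G1 \<times>\<times> G2 \<times>\<times> G2)
           (prod_topology E1 (prod_topology E1 (prod_topology E2 E2)))
           (prod_act a1 (prod_act a1 (prod_act a2 a2)))"
  shows "TC (G1 \<times>\<times> G2)
            (prod_topology E1 E2) (prod_act a1 a2)
            (prod_topology B1 B2) (prod_act b1 b2) (map_prod p1 p2)
         \<le> TC G1 E1 a1 B1 b1 p1 + TC G2 E2 a2 B2 b2 p2 - 1"
proof -
  let ?Y1 = "TC_target G1 E1 b1 p1" and ?Y2 = "TC_target G2 E2 b2 p2"
  let ?G = "(G1 \<times>\<times> G1) \<times>\<times> (G2 \<times>\<times> G2)"
  let ?aY = "prod_act (prod_act a1 a1) (prod_act a2 a2)"
  have G1: "group G1" and G2: "group G2"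
    using E1 E2 by (auto simp: G_space_def topological_group_def)
  have inv1: "G_invariant (G1 \<times>\<times> G1) (prod_act a1 a1) (topspace ?Y1)"
    using E1 B1 p1 by (rule G_invariant_TC_target)
  have inv2: "G_invariant (G2 \<times>\<times> G2) (prod_act a2 a2) (topspace ?Y2)"
    using E2 B2 p2 by (rule G_invariant_TC_target)
  have normal: "G_completely_normal ?G (prod_topology ?Y1 ?Y2) ?aY"
  proof (rule G_completely_normal_embedding[OF cn])
    let ?W = "prod_topology (prod_topology E1 E1) (prod_topology E2 E2)"
    let ?Z = "prod_topology E1 (prod_topology E1 (prod_topology E2 E2))"
    (* complete normality passes to every invariant subspace, whatever set S cuts it out *)
    obtain S where S: "prod_topology ?Y1 ?Y2 = subtopology ?W S"
      unfolding TC_target_def subtopology_Times[symmetric] by blast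
    have hom: "homeomorphic_map ?W ?Z reassoc"
      by (rule homeomorphic_map_reassoc)
    have "homeomorphic_map (subtopology ?W S) (subtopology ?Z (reassoc ` topspace (subtopology ?W S)))
        reassoc"
      using homeomorphic_imp_surjective_map[OF hom] hom
      by (intro homeomorphic_map_subtopologies) auto
    then show "embedding_map (prod_topology ?Y1 ?Y2) ?Z reassoc"
      by (simp add: embedding_map_def S)
    show "reassoc ` carrier ?G = carrier (G1 \<times>\<times> G1 \<times>\<times> G2 \<times>\<times> G2)"
      by (force simp: reassoc_def image_iff)
    show "G_invariant ?G ?aY (topspace (prod_topology ?Y1 ?Y2))"
      using inv1 inv2 by (auto simp: G_invariant_def prod_act_def)
  qed (auto simp: reassoc_def prod_act_def)
  have undo: "prod_act a a (inv\<^bsub>G \<times>\<times> G\<^esub> g) (prod_act a a g y) = y"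
    if "group G" "G_space G T E a" "g \<in> carrier (G \<times>\<times> G)" "y \<in> topspace (TC_target G E b p)"
    for G T E a b p g y
    using that G_space_inv_undo[OF that(2)] by (auto simp: prod_act_def topspace_TC_target)
  have "TC (G1 \<times>\<times> G2) (prod_topology E1 E2) (prod_act a1 a2)
          (prod_topology B1 B2) (prod_act b1 b2) (map_prod p1 p2)
      \<le> secat ?G (prod_topology (TC_source G1 E1 a1 B1 p1) (TC_source G2 E2 a2 B2 p2))
          (prod_act (prod_act (path_act a1) (path_act a1)) (prod_act (path_act a2) (path_act a2)))
          (prod_topology ?Y1 ?Y2) ?aY (map_prod TC_map TC_map)"
    unfolding TC_def
  proof (rule secat_transfer[where \<phi> = swap_middle, OF homeomorphic_maps_TC_target_prod[OF G1 G2]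
        _ _ _ continuous_map_TC_source_pair[OF G1 G2]])
    show "swap_middle g \<in> carrier ?G" if "g \<in> carrier ((G1 \<times>\<times> G2) \<times>\<times> G1 \<times>\<times> G2)" for g
      using that by (auto simp: swap_middle_def)
  qed (simp_all add: swap_middle_prod_act TC_source_pair_act TC_map_TC_source_pair)
  also have "\<dots> \<le> TC G1 E1 a1 B1 b1 p1 + TC G2 E2 a2 B2 b2 p2 - 1"
    unfolding TC_def
    by (rule secat_prod_le[OF DirProd_group[OF G1 G1] DirProd_group[OF G2 G2]
          undo[OF G1 E1] undo[OF G2 E2] normal])
  finally show ?thesis .
qed

theorem theorem4p17:
  fixes G1 :: "('g1, 'm1) monoid_scheme" and T1 :: "'g1 topology"
    and G2 :: "('g2, 'm2) monoid_scheme" and T2 :: "'g2 topology"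
    and E1 :: "'e1 topology" and a1 :: "'g1 \<Rightarrow> 'e1 \<Rightarrow> 'e1"
    and B1 :: "'b1 topology" and b1 :: "'g1 \<Rightarrow> 'b1 \<Rightarrow> 'b1" and p1 :: "'e1 \<Rightarrow> 'b1"
    and E2 :: "'e2 topology" and a2 :: "'g2 \<Rightarrow> 'e2 \<Rightarrow> 'e2"
    and B2 :: "'b2 topology" and b2 :: "'g2 \<Rightarrow> 'b2 \<Rightarrow> 'b2" and p2 :: "'e2 \<Rightarrow> 'b2"
  assumes "topological_group G1 T1" and "topological_group G2 T2"
    and "G_fibration G1 T1 E1 a1 B1 b1 p1"
    and "G_fibration G2 T2 E2 a2 B2 b2 p2"
    and "G_completely_normal (G1 \<times>\<times> G1 \<times>\<times> G2 \<times>\<times> G2)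
           (prod_topology E1 (prod_topology E1 (prod_topology E2 E2)))
           (prod_act a1 (prod_act a1 (prod_act a2 a2)))"
  shows "TC (G1 \<times>\<times> G2)
            (prod_topology E1 E2) (prod_act a1 a2)
            (prod_topology B1 B2) (prod_act b1 b2) (map_prod p1 p2)
         \<le> TC G1 E1 a1 B1 b1 p1 + TC G2 E2 a2 B2 b2 p2 - 1"
proof -
  have "G_space G1 T1 E1 a1" "G_space G1 T1 B1 b1" "G_map G1 E1 a1 B1 b1 p1"
    using assms(3) by (simp_all add: G_fibration_def)
  moreover have "G_space G2 T2 E2 a2" "G_space G2 T2 B2 b2" "G_map G2 E2 a2 B2 b2 p2"
    using assms(4) by (simp_all add: G_fibration_def)
  ultimately show ?thesis
    using assms(5) by (rule TC_prod_le)
qed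

end
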